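(* There is an absolute constant $\kappa>0$ such that, with $f(x,y)=xy(x+y)$, for any two nonempty finite sets $A,B$ of nonzero real numbers one has $$|f(A,B)|\ge\kappa|A|^{2/3}|B|^{2/3}.$$
   Context: $f(A,B)=\{f(a,b): (a,b)\in A\times B\}$. *)

theory Defs
  imports Complex_Main
begin

definition f_poly :: "real \<Rightarrow> real \<Rightarrow> real" where
  "f_poly x y = x * y * (x + y)"

definition image_prod :: "('a \<Rightarrow> 'b \<Rightarrow> 'c) \<Rightarrow> 'a set \<Rightarrow> 'b set \<Rightarrow> 'c set" where
  "image_prod f A B = {f a b | a b. (a, b) \<in> A \<times> B}"

end

theory Submission
  imports Defs "HOL-Analysis.Convex"
begin

text \<open>
  The number of elements of \<open>f(A,B)\<close> is controlled by the energy, the number of solutions of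
  \<open>f(a,x) = f(d,y)\<close> with \<open>a, d \<in> A\<close> and \<open>x, y \<in> B\<close>: by Cauchy-Schwarz, few values force many
  coincidences (\<open>card_sq_le_card_image_energy\<close>). So the energy has to be bounded from above.

  For fixed \<open>(a,d)\<close> the equation \<open>f(a,x) = f(d,y)\<close> describes a conic in the \<open>(x,y)\<close>-plane, and the
  energy counts incidences between \<open>|A|\<^sup>2\<close> conics and the \<open>|B|\<^sup>2\<close> points of the grid \<open>B \<times> B\<close>. A
  bound of Szemeredi-Trotter strength is needed, but two features make it elementary. The points
  form a grid, so the plane can be partitioned by horizontal and vertical lines. And the pair
  \<open>(a,x)\<close> can be restricted, at the cost of a factor 4, to one class of signs of \<open>a\<close> and of
  \<open>a + 2x\<close>: since \<open>f(a,x') - f(a,x) = a (x' - x) (a + x + x')\<close>, the function \<open>f(a,\<cdot>)\<close> is then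
  monotone in a direction common to all \<open>a\<close>, and every conic becomes the graph of an increasing
  partial function (\<open>large_increasing_subset\<close>).

  Cut \<open>B\<close> into consecutive blocks of at most \<open>t\<close> elements. An increasing curve meets only
  \<open>O(|B|/t)\<close> of the resulting cells, and every further point on it shares a cell with an earlier
  one. There are at most \<open>|B|\<^sup>2 t\<^sup>2\<close> pairs of points in a common cell, and off the diagonal
  each lies on at most three conics (\<open>card_common_solutions_le_3\<close>): the parameters \<open>(a,d)\<close> of the
  conics through a given point form a conic themselves, and two of these meet in at most four
  points by Bezout, one of which is the origin.
  Hence there are \<open>O(|A|\<^sup>2 |B|/t + |B|\<^sup>2 t\<^sup>2)\<close> incidences
  (\<open>sum_card_increasing_curves_le\<close>). The solutions on the diagonal \<open>x = y\<close>, which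
  after the restriction of signs include all those with \<open>a = d\<close>, add only \<open>O(|A| |B|)\<close> to the
  energy (\<open>energy_le\<close>).

  The two terms balance at \<open>t \<approx> |A|\<^bsup>2/3\<^esup> |B|\<^bsup>-1/3\<^esup>\<close>, where the energy is \<open>O((|A| |B|)\<^bsup>4/3\<^esup>)\<close>,
  which is what the theorem needs. This choice is a legitimate block size if \<open>|B| \<le> |A|\<^sup>2\<close> and
  \<open>|A| \<le> |B|\<^sup>2\<close>. As \<open>f\<close> is symmetric one may assume \<open>|A| \<le> |B|\<close>; and if \<open>|B| > |A|\<^sup>2\<close>, the
  bound \<open>|f(A,B)| \<ge> |B|/2\<close> coming from a single \<open>a \<in> A\<close> is already strong enough.
\<close>

section \<open>Increasing curves in a grid\<close>

text \<open>One representative per fibre of \<open>s\<close> accounts for the image; every other element collides with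
  the representative of its fibre.\<close>

lemma card_le_image_plus_collisions:
  assumes "finite \<Gamma>"
  shows "card \<Gamma> \<le> card (s ` \<Gamma>) + card {(p, q). p \<in> \<Gamma> \<and> q \<in> \<Gamma> \<and> p \<noteq> q \<and> s p = s q}"
    (is "_ \<le> _ + card ?C")
proof -
  define r where "r p = inv_into \<Gamma> s (s p)" for p
  have r: "r p \<in> \<Gamma>" "s (r p) = s p" if "p \<in> \<Gamma>" for p
    using that unfolding r_def by (auto intro: inv_into_into f_inv_into_f)
  have finC: "finite ?C"
    by (rule finite_subset[of _ "\<Gamma> \<times> \<Gamma>"]) (use assms in auto)
  have "inj_on s {p \<in> \<Gamma>. r p = p}"
    by (rule inj_onI) (metis (mono_tags, lifting) mem_Collect_eq r_def)
  hence 1: "card {p \<in> \<Gamma>. r p = p} \<le> card (s ` \<Gamma>)"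
    by (rule card_inj_on_le) (use assms in auto)
  have "card {p \<in> \<Gamma>. r p \<noteq> p} \<le> card ?C"
    by (rule card_inj_on_le[of "\<lambda>p. (p, r p)"]) (use finC r in \<open>auto simp: inj_on_def\<close>)
  moreover have "card \<Gamma> = card {p \<in> \<Gamma>. r p = p} + card {p \<in> \<Gamma>. r p \<noteq> p}"
    by (subst card_Un_disjoint[symmetric]) (use assms in \<open>auto intro: arg_cong[of _ _ card]\<close>)
  ultimately show ?thesis using 1 by linarith
qed

text \<open>Divide the rank of an element in \<open>B\<close> by \<open>t\<close>.\<close>

lemma monotone_blocks:
  fixes B :: "'a :: linorder set"
  assumes "finite B" "0 < t"
  obtains g :: "'a \<Rightarrow> nat"
  where "mono_on B g"
    and "\<And>b. b \<in> B \<Longrightarrow> g b \<le> (card B - 1) div t"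
    and "\<And>i. card {b \<in> B. g b = i} \<le> t"
proof
  define \<rho> where "\<rho> b = card {x \<in> B. x < b}" for b
  define g where "g b = \<rho> b div t" for b
  have less: "\<rho> x < \<rho> y" if "x \<in> B" "x < y" for x y
    unfolding \<rho>_def by (rule psubset_card_mono) (use assms that in auto)
  have inj: "inj_on \<rho> B"
    by (rule inj_onI) (metis less less_irrefl linorder_neqE)
  show "mono_on B g"
    unfolding g_def by (rule mono_onI) (metis div_le_mono le_less less order_refl)
  show "g b \<le> (card B - 1) div t" if "b \<in> B" for b
  proof -
    have "\<rho> b < card B"
      unfolding \<rho>_def by (rule psubset_card_mono) (use assms that in auto)
    thus ?thesis unfolding g_def by (intro div_le_mono) linarith
  qed
  show "card {b \<in> B. g b = i} \<le> t" for i
  proof -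
    have "\<rho> b \<in> {i * t..<i * t + t}" if "g b = i" for b
      using that assms(2) unfolding g_def
      by (metis add.commute atLeastLessThan_iff div_times_less_eq_dividend dividend_less_div_times)
    hence "card {b \<in> B. g b = i} \<le> card {i * t..<i * t + t}"
      by (intro card_inj_on_le[of \<rho>]) (auto intro: inj_on_subset[OF inj])
    thus ?thesis by simp
  qed
qed

text \<open>An incidence bound by cell decomposition. Indexing a cell by the sum of its two block indices
  separates the cells met by one increasing curve, so such a curve meets at most \<open>2 (|B| - 1)/t + 1\<close>
  of them. Every point beyond one per cell produces a pair of points of the curve in a common cell;
  summed over all curves, each such pair is counted at most \<open>k\<close> times. The condition \<open>t \<le> |B|\<close>
  serves to absorb the summand \<open>1\<close> into \<open>3 |B|/t\<close>.\<close>

lemma sum_card_increasing_curves_le: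
  fixes B :: "'a :: linorder set" and \<Gamma> :: "'i \<Rightarrow> ('a \<times> 'a) set"
  assumes B: "finite B" and I: "finite I" and t: "0 < t" "t \<le> card B"
    and sub: "\<And>i. i \<in> I \<Longrightarrow> \<Gamma> i \<subseteq> B \<times> B"
    and inc: "\<And>i x y x' y'. i \<in> I \<Longrightarrow> (x, y) \<in> \<Gamma> i \<Longrightarrow> (x', y') \<in> \<Gamma> i \<Longrightarrow> x < x' \<longleftrightarrow> y < y'"
    and mult: "\<And>x y x' y'. x \<noteq> x' \<Longrightarrow> card {i \<in> I. (x, y) \<in> \<Gamma> i \<and> (x', y') \<in> \<Gamma> i} \<le> k"
  shows "real (\<Sum>i\<in>I. card (\<Gamma> i))
      \<le> 3 * real (card I) * real (card B) / real t + real k * (real (card B))\<^sup>2 * (real t)\<^sup>2"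
proof -
  define n where "n = card B"
  obtain g :: "'a \<Rightarrow> nat" where g: "mono_on B g" "\<And>b. b \<in> B \<Longrightarrow> g b \<le> (n - 1) div t"
      and fib: "\<And>i. card {b \<in> B. g b = i} \<le> t"
    using monotone_blocks[OF B t(1)] unfolding n_def by metis
  define N where "N = (n - 1) div t"
  define s where "s p = g (fst p) + g (snd p)" for p
  define D where "D = (SIGMA x:B. {y \<in> B. g y = g x})"
  \<comment> \<open>\<open>D\<close> holds the pairs of coordinates in one block, \<open>P\<close> the pairs of points in one cell. On an
    increasing curve distinct points have distinct abscissae, hence the condition \<open>x \<noteq> x'\<close>.\<close>
  define P where "P = {((x, y), (x', y')). (x, x') \<in> D \<and> (y, y') \<in> D \<and> x \<noteq> x'}"
  have finD: "finite D" unfolding D_def using B by auto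
  have injP: "inj_on (\<lambda>(p, q). ((fst p, fst q), (snd p, snd q))) P"
    by (auto simp: inj_on_def)
  have imP: "(\<lambda>(p, q). ((fst p, fst q), (snd p, snd q))) ` P \<subseteq> D \<times> D"
    by (auto simp: P_def)
  have finP: "finite P"
    using finite_subset[OF imP] finD finite_imageD[OF _ injP] by blast
  have "card D = (\<Sum>x\<in>B. card {y \<in> B. g y = g x})"
    unfolding D_def by (rule card_SigmaI) (use B in auto)
  also have "\<dots> \<le> (\<Sum>x\<in>B. t)" by (intro sum_mono fib)
  finally have cD: "card D \<le> n * t" by (simp add: n_def)
  have "card P \<le> card (D \<times> D)"
    by (rule card_inj_on_le[OF injP imP]) (use finD in auto)
  also have "\<dots> \<le> (n * t) * (n * t)"
    unfolding card_cartesian_product by (intro mult_mono cD) auto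
  finally have cP: "card P \<le> (n * t) * (n * t)" .
  have curve: "card (\<Gamma> i) \<le> (2 * N + 1) + card {pq \<in> P. fst pq \<in> \<Gamma> i \<and> snd pq \<in> \<Gamma> i}"
    if i: "i \<in> I" for i
  proof -
    have fin: "finite (\<Gamma> i)" using sub[OF i] B finite_subset by blast
    have "s ` \<Gamma> i \<subseteq> {..2 * N}"
    proof (rule image_subsetI)
      fix p assume "p \<in> \<Gamma> i"
      hence "g (fst p) \<le> N" "g (snd p) \<le> N" using sub[OF i] g(2) unfolding N_def by auto
      thus "s p \<in> {..2 * N}" unfolding s_def by simp
    qed
    hence "card (s ` \<Gamma> i) \<le> card {..2 * N}" by (intro card_mono) auto
    moreover have "{(p, q). p \<in> \<Gamma> i \<and> q \<in> \<Gamma> i \<and> p \<noteq> q \<and> s p = s q}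
        \<subseteq> {pq \<in> P. fst pq \<in> \<Gamma> i \<and> snd pq \<in> \<Gamma> i}"
    proof (rule subsetI)
      fix pq assume "pq \<in> {(p, q). p \<in> \<Gamma> i \<and> q \<in> \<Gamma> i \<and> p \<noteq> q \<and> s p = s q}"
      then obtain x y x' y' where pq: "pq = ((x, y), (x', y'))"
        and p: "(x, y) \<in> \<Gamma> i" and q: "(x', y') \<in> \<Gamma> i"
        and ne: "\<not> (x = x' \<and> y = y')" and eq: "s (x, y) = s (x', y')"
        by (cases pq) auto
      have mem: "x \<in> B" "y \<in> B" "x' \<in> B" "y' \<in> B" using sub[OF i] p q by auto
      have iff: "x < x' \<longleftrightarrow> y < y'" "x' < x \<longleftrightarrow> y' < y"
        using inc[OF i p q] inc[OF i q p] by auto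
      hence nx: "x \<noteq> x'" using ne by (cases y y' rule: linorder_cases) auto
      \<comment> \<open>Along an increasing curve both block indices move in the same direction,
        so a constant sum forces both of them to be constant.\<close>
      have "g x = g x' \<and> g y = g y'"
      proof (cases "x < x'")
        case True
        hence "g x \<le> g x'" "g y \<le> g y'"
          using iff g(1) mem by (auto intro: mono_onD)
        thus ?thesis using eq unfolding s_def by simp
      next
        case False
        hence "g x' \<le> g x" "g y' \<le> g y"
          using iff nx g(1) mem by (auto intro: mono_onD)
        thus ?thesis using eq unfolding s_def by simp
      qed
      thus "pq \<in> {pq \<in> P. fst pq \<in> \<Gamma> i \<and> snd pq \<in> \<Gamma> i}"
        using p q mem nx unfolding pq P_def D_def by auto
    qed
    hence "card {(p, q). p \<in> \<Gamma> i \<and> q \<in> \<Gamma> i \<and> p \<noteq> q \<and> s p = s q}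
        \<le> card {pq \<in> P. fst pq \<in> \<Gamma> i \<and> snd pq \<in> \<Gamma> i}"
      by (intro card_mono) (use finP in auto)
    ultimately show ?thesis
      using card_le_image_plus_collisions[OF fin, of s] by simp
  qed
  have "(\<Sum>i\<in>I. card {pq \<in> P. fst pq \<in> \<Gamma> i \<and> snd pq \<in> \<Gamma> i})
      = (\<Sum>pq\<in>P. card {i \<in> I. fst pq \<in> \<Gamma> i \<and> snd pq \<in> \<Gamma> i})"
    by (rule sum_multicount_gen) (use I finP in auto)
  also have "\<dots> \<le> (\<Sum>pq\<in>P. k)"
  proof (rule sum_mono)
    fix pq assume "pq \<in> P"
    then obtain x y x' y' where "pq = ((x, y), (x', y'))" "x \<noteq> x'"
      unfolding P_def by auto
    thus "card {i \<in> I. fst pq \<in> \<Gamma> i \<and> snd pq \<in> \<Gamma> i} \<le> k"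
      using mult[of x x' y y'] by simp
  qed
  also have "\<dots> \<le> k * ((n * t) * (n * t))" using cP by simp
  finally have coll: "(\<Sum>i\<in>I. card {pq \<in> P. fst pq \<in> \<Gamma> i \<and> snd pq \<in> \<Gamma> i}) \<le> k * ((n * t) * (n * t))" .
  have "(\<Sum>i\<in>I. card (\<Gamma> i))
      \<le> (\<Sum>i\<in>I. (2 * N + 1) + card {pq \<in> P. fst pq \<in> \<Gamma> i \<and> snd pq \<in> \<Gamma> i})"
    by (intro sum_mono curve)
  also have "\<dots> \<le> card I * (2 * N + 1) + k * ((n * t) * (n * t))"
    unfolding sum.distrib using coll by simp
  finally have "real (\<Sum>i\<in>I. card (\<Gamma> i)) \<le> real (card I * (2 * N + 1) + k * ((n * t) * (n * t)))"
    by (rule of_nat_mono)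
  also have "\<dots> = real (card I) * (2 * real N + 1) + real k * (real n)\<^sup>2 * (real t)\<^sup>2"
    by (simp add: power2_eq_square algebra_simps)
  finally have main: "real (\<Sum>i\<in>I. card (\<Gamma> i))
      \<le> real (card I) * (2 * real N + 1) + real k * (real n)\<^sup>2 * (real t)\<^sup>2" .
  have "N * t \<le> n" unfolding N_def using div_times_less_eq_dividend[of "n - 1" t] by linarith
  hence "(2 * N + 1) * t \<le> 3 * n" using t by (simp add: n_def algebra_simps)
  hence "real ((2 * N + 1) * t) \<le> real (3 * n)" by (rule of_nat_mono)
  hence "2 * real N + 1 \<le> 3 * real n / real t"
    using t by (simp add: field_simps)
  hence "real (card I) * (2 * real N + 1) \<le> real (card I) * (3 * real n / real t)"
    by (intro mult_left_mono) auto
  thus ?thesis using main by (simp add: n_def mult.assoc mult.left_commute)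
qed

section \<open>The curves a b (a + b) = a' b' (a' + b')\<close>

lemma f_poly_commute: "f_poly x y = f_poly y x"
  by (simp add: f_poly_def)

text \<open>Here \<open>(b, c)\<close> and \<open>(b', c')\<close> are two points and the unknown is the curve \<open>(a, d)\<close>. Both equations
  are quadratic in \<open>a\<close>; eliminating \<open>a\<^sup>2\<close> expresses \<open>a = P d\<^sup>2 + Q d\<close> as a function of \<open>d\<close>, and
  substituting this back leaves, after division by \<open>d\<close>, a cubic equation for \<open>d\<close>. Its
  coefficients could all vanish only if \<open>P = 0\<close> and \<open>Q\<^sup>3 = 1\<close>, hence \<open>c = b Q\<^sup>2 = b\<close>; points on the
  diagonal have to be excluded because all curves \<open>a = d\<close> share it.\<close>

lemma card_common_solutions_le_3:
  fixes b c b' c' :: real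
  assumes nz: "b \<noteq> 0" "c \<noteq> 0" "b' \<noteq> 0" "c' \<noteq> 0" and bc: "b \<noteq> b'" and diag: "b \<noteq> c"
  defines "X \<equiv> {(a, d). d \<noteq> 0 \<and> f_poly a b = f_poly d c \<and> f_poly a b' = f_poly d c'}"
  shows "finite X" "card X \<le> 3"
proof -
  define P Q where "P = (c * b' - c' * b) / (b * b' * (b - b'))"
    and "Q = (c\<^sup>2 * b' - c'\<^sup>2 * b) / (b * b' * (b - b'))"
  \<comment> \<open>The coefficients of the cubic equation for \<open>d\<close>, by increasing degree.\<close>
  define k :: "nat \<Rightarrow> real" where
    "k i = [b\<^sup>2 * Q - c\<^sup>2, b * Q\<^sup>2 + b\<^sup>2 * P - c, 2 * b * P * Q, b * P\<^sup>2] ! i" for i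
  have sol: "a = P * d\<^sup>2 + Q * d \<and> (\<Sum>i\<le>3. k i * d ^ i) = 0" if "(a, d) \<in> X" for a d
  proof
    have e: "b * a\<^sup>2 + b\<^sup>2 * a = c * d\<^sup>2 + c\<^sup>2 * d" "b' * a\<^sup>2 + b'\<^sup>2 * a = c' * d\<^sup>2 + c'\<^sup>2 * d"
      and d: "d \<noteq> 0"
      using that by (auto simp: X_def f_poly_def power2_eq_square algebra_simps)
    have "(b * b' * (b - b')) * a = b' * (b * a\<^sup>2 + b\<^sup>2 * a) - b * (b' * a\<^sup>2 + b'\<^sup>2 * a)"
      by (simp add: power2_eq_square algebra_simps)
    also have "\<dots> = (c * b' - c' * b) * d\<^sup>2 + (c\<^sup>2 * b' - c'\<^sup>2 * b) * d"
      unfolding e by (simp add: algebra_simps)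
    also have "\<dots> = (b * b' * (b - b')) * (P * d\<^sup>2 + Q * d)"
      using nz bc unfolding P_def Q_def by (simp add: distrib_left)
    finally show a: "a = P * d\<^sup>2 + Q * d" using nz bc by simp
    have "d * (\<Sum>i\<le>3. k i * d ^ i) = (b * a\<^sup>2 + b\<^sup>2 * a) - (c * d\<^sup>2 + c\<^sup>2 * d)"
      unfolding a k_def by (simp add: numeral_3_eq_3 power2_eq_square algebra_simps)
    thus "(\<Sum>i\<le>3. k i * d ^ i) = 0" using e d by simp
  qed
  have "\<exists>j\<le>3. k j \<noteq> 0"
  proof (rule ccontr)
    assume "\<not> ?thesis"
    hence z: "k 0 = 0" "k 1 = 0" "k 3 = 0" by auto
    have P0: "P = 0" using z(3) nz by (simp add: k_def numeral_3_eq_3)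
    have c1: "c = b * Q\<^sup>2" and c2: "c\<^sup>2 = b\<^sup>2 * Q"
      using z(1,2) P0 by (simp_all add: k_def)
    have "b\<^sup>2 * Q * (Q ^ 3 - 1) = 0"
      using c2 unfolding c1 by (simp add: power_mult_distrib algebra_simps eval_nat_numeral)
    hence "Q = 0 \<or> Q ^ 3 = 1" using nz by simp
    moreover have "Q ^ 3 - 1 = (Q - 1) * ((Q + 1/2)\<^sup>2 + 3/4)"
      by (simp add: eval_nat_numeral algebra_simps)
    moreover have "(Q + 1/2)\<^sup>2 + 3/4 \<noteq> 0"
      using zero_le_power2[of "Q + 1/2"] by linarith
    ultimately have "Q = 0 \<or> Q = 1" by auto
    thus False using c1 nz diag by auto
  qed
  then obtain j where "k j \<noteq> 0" "j \<le> 3" by blast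
  from polyfun_rootbound[where c = k, OF this]
  have R: "finite {d. (\<Sum>i\<le>3. k i * d ^ i) = 0}" "card {d. (\<Sum>i\<le>3. k i * d ^ i) = 0} \<le> 3"
    by auto
  have "X \<subseteq> (\<lambda>d. (P * d\<^sup>2 + Q * d, d)) ` {d. (\<Sum>i\<le>3. k i * d ^ i) = 0}"
    using sol by force
  thus "finite X" "card X \<le> 3"
    using R by (blast intro: finite_subset, meson surj_card_le order_trans)
qed

text \<open>The parabola \<open>x \<mapsto> f(a,x)\<close> has its vertex at \<open>-a/2\<close>, so it is monotone on each side of it; \<open>v\<close>
  records the side.\<close>

lemma f_poly_less_iff:
  assumes "a \<noteq> 0" "0 \<le> a + 2 * b \<longleftrightarrow> v" "0 \<le> a + 2 * b' \<longleftrightarrow> v"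
  shows "f_poly a b < f_poly a b' \<longleftrightarrow> (if (0 < a) = v then b < b' else b' < b)"
proof -
  have "f_poly a b' - f_poly a b = a * ((b' - b) * (a + b + b'))"
    by (simp add: f_poly_def algebra_simps)
  hence 1: "f_poly a b < f_poly a b' \<longleftrightarrow> 0 < a * ((b' - b) * (a + b + b'))" by linarith
  show ?thesis
  proof (cases "b = b'")
    case False
    show ?thesis
    proof (cases v)
      case True
      hence "a + b + b' > 0" using assms False by linarith
      hence "0 < a * ((b' - b) * (a + b + b')) \<longleftrightarrow> 0 < a * (b' - b)"
        by (simp add: zero_less_mult_iff mult_less_0_iff)
      thus ?thesis unfolding 1 using assms(1) True False by (auto simp: zero_less_mult_iff)
    next
      case False': False
      hence "a + b + b' < 0" using assms by linarith
      hence "0 < a * ((b' - b) * (a + b + b')) \<longleftrightarrow> a * (b' - b) < 0"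
        by (simp add: zero_less_mult_iff mult_less_0_iff)
      thus ?thesis unfolding 1 using assms(1) False' False by (auto simp: mult_less_0_iff)
    qed
  qed (simp add: 1)
qed

text \<open>For all \<open>a\<close> and \<open>d\<close>, the part of the conic \<open>f(a,x) = f(d,y)\<close> cut out by \<open>(a,x) \<in> S\<close> and
  \<open>(d,y) \<in> S\<close> is the graph of a strictly increasing partial function.\<close>

definition increasing_fibres :: "(real \<times> real) set \<Rightarrow> bool" where
  "increasing_fibres S \<longleftrightarrow> (\<forall>a d x y x' y'.
     (a, x) \<in> S \<longrightarrow> (d, y) \<in> S \<longrightarrow> (a, x') \<in> S \<longrightarrow> (d, y') \<in> S \<longrightarrow>
     f_poly a x = f_poly d y \<longrightarrow> f_poly a x' = f_poly d y' \<longrightarrow> (x < x' \<longleftrightarrow> y < y'))"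

text \<open>On the set where the signs of \<open>a\<close> and of \<open>a + 2x\<close> are prescribed, all the functions \<open>f(a,\<cdot>)\<close>
  are strictly monotone in the same direction. Four such sets cover \<open>A \<times> B\<close>.\<close>

lemma large_increasing_subset:
  assumes fin: "finite A" "finite B" and "0 \<notin> A"
  obtains S where "S \<subseteq> A \<times> B" "card A * card B \<le> 4 * card S" "increasing_fibres S"
proof -
  define S where "S u v = {(a, b) \<in> A \<times> B. (0 < a \<longleftrightarrow> u) \<and> (0 \<le> a + 2 * b \<longleftrightarrow> v)}" for u v
  have "A \<times> B = (S True True \<union> S True False) \<union> (S False True \<union> S False False)"
    unfolding S_def by auto
  hence "card (A \<times> B) \<le> card (S True True \<union> S True False) + card (S False True \<union> S False False)"
    using card_Un_le by metis
  also have "\<dots> \<le> (card (S True True) + card (S True False)) + (card (S False True) + card (S False False))"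
    by (intro add_mono card_Un_le)
  finally have le: "card A * card B
      \<le> (card (S True True) + card (S True False)) + (card (S False True) + card (S False False))"
    by (simp add: card_cartesian_product)
  have "\<exists>u v. card A * card B \<le> 4 * card (S u v)"
  proof (rule ccontr)
    assume "\<nexists>u v. card A * card B \<le> 4 * card (S u v)"
    hence "4 * card (S u v) < card A * card B" for u v by (meson not_le)
    from this[of True True] this[of True False] this[of False True] this[of False False] le
    show False by linarith
  qed
  then obtain u v where uv: "card A * card B \<le> 4 * card (S u v)" by blast
  have "increasing_fibres (S u v)"
    unfolding increasing_fibres_def
  proof (intro allI impI)
    fix a d x y x' y'
    assume m: "(a, x) \<in> S u v" "(d, y) \<in> S u v" "(a, x') \<in> S u v" "(d, y') \<in> S u v"
      and e: "f_poly a x = f_poly d y" "f_poly a x' = f_poly d y'"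
    have nz: "a \<noteq> 0" "d \<noteq> 0" using m \<open>0 \<notin> A\<close> by (auto simp: S_def)
    have s: "0 < a \<longleftrightarrow> u" "0 < d \<longleftrightarrow> u" "0 \<le> a + 2 * x \<longleftrightarrow> v" "0 \<le> d + 2 * y \<longleftrightarrow> v"
      "0 \<le> a + 2 * x' \<longleftrightarrow> v" "0 \<le> d + 2 * y' \<longleftrightarrow> v"
      using m by (auto simp: S_def)
    show "x < x' \<longleftrightarrow> y < y'"
      using f_poly_less_iff[OF nz(1) s(3,5)] f_poly_less_iff[OF nz(2) s(4,6)]
        f_poly_less_iff[OF nz(1) s(5,3)] f_poly_less_iff[OF nz(2) s(6,4)] e s(1,2)
      by (auto split: if_splits)
  qed
  moreover have "S u v \<subseteq> A \<times> B" by (auto simp: S_def)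
  ultimately show thesis using uv that by blast
qed

section \<open>The energy bound\<close>

text \<open>The incidence bound applies to the solutions with \<open>x \<noteq> y\<close>, because two points off the diagonal
  lie on at most three curves. In a solution with \<open>x = y\<close> either \<open>d = a\<close> or \<open>d = -a-x\<close>, so there
  are at most two for each element of \<open>S\<close>.\<close>

lemma energy_le:
  assumes fin: "finite A" "finite B" and nz: "0 \<notin> A" "0 \<notin> B"
    and S: "S \<subseteq> A \<times> B" "increasing_fibres S" and t: "0 < t" "t \<le> card B"
  defines "E \<equiv> {(p, q). p \<in> S \<and> q \<in> S \<and> case_prod f_poly p = case_prod f_poly q}"
  shows "real (card E) \<le> 3 * (real (card A))\<^sup>2 * real (card B) / real t
      + 3 * (real (card B))\<^sup>2 * (real t)\<^sup>2 + 2 * real (card A) * real (card B)"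
proof -
  define \<Gamma> where "\<Gamma> = (\<lambda>(a, d). {(x, y). (a, x) \<in> S \<and> (d, y) \<in> S \<and> x \<noteq> y \<and> f_poly a x = f_poly d y})"
  have sub: "\<Gamma> i \<subseteq> B \<times> B" for i
    using S(1) by (cases i) (auto simp: \<Gamma>_def)
  have finG: "finite (\<Gamma> i)" for i
    using finite_subset[OF sub] fin by blast
  have finS: "finite S" using S(1) fin finite_subset by blast
  have inc: "x < x' \<longleftrightarrow> y < y'" if "(x, y) \<in> \<Gamma> i" "(x', y') \<in> \<Gamma> i" for i x y x' y'
    using that S(2) unfolding increasing_fibres_def \<Gamma>_def by (cases i) blast
  have mult: "card {i \<in> A \<times> A. (x, y) \<in> \<Gamma> i \<and> (x', y') \<in> \<Gamma> i} \<le> 3" if "x \<noteq> x'" for x y x' y'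
  proof (cases "{i \<in> A \<times> A. (x, y) \<in> \<Gamma> i \<and> (x', y') \<in> \<Gamma> i} = {}")
    case False
    hence "x \<noteq> 0" "y \<noteq> 0" "x' \<noteq> 0" "y' \<noteq> 0" "x \<noteq> y"
      using S(1) nz(2) by (auto simp: \<Gamma>_def)
    note b = card_common_solutions_le_3[OF this(1,2,3,4) that this(5)]
    have "card {i \<in> A \<times> A. (x, y) \<in> \<Gamma> i \<and> (x', y') \<in> \<Gamma> i}
      \<le> card {(a, d). d \<noteq> 0 \<and> f_poly a x = f_poly d y \<and> f_poly a x' = f_poly d y'}"
      by (rule card_mono[OF b(1)]) (use nz(1) in \<open>auto simp: \<Gamma>_def\<close>)
    thus ?thesis using b(2) by linarith
  next
    case True
    thus ?thesis by (simp only: card.empty)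
  qed
  have main: "real (\<Sum>i\<in>A \<times> A. card (\<Gamma> i)) \<le> 3 * real (card (A \<times> A)) * real (card B) / real t
      + real 3 * (real (card B))\<^sup>2 * (real t)\<^sup>2"
    by (rule sum_card_increasing_curves_le) (use fin t sub inc mult in auto)
  \<comment> \<open>The three parts are the incidences off the diagonal, and the cases \<open>d = a\<close> and \<open>d = -a-x\<close> on it.\<close>
  have "E \<subseteq> (\<lambda>((a, d), (x, y)). ((a, x), (d, y))) ` (SIGMA i:A \<times> A. \<Gamma> i)
      \<union> ((\<lambda>p. (p, p)) ` S \<union> (\<lambda>(a, x). ((a, x), (- a - x, x))) ` S)"
  proof (rule subsetI)
    fix pq assume "pq \<in> E"
    then obtain a x d y where pq: "pq = ((a, x), (d, y))"
      and m: "(a, x) \<in> S" "(d, y) \<in> S" and e: "f_poly a x = f_poly d y"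
      by (cases pq) (auto simp: E_def)
    show "pq \<in> (\<lambda>((a, d), (x, y)). ((a, x), (d, y))) ` (SIGMA i:A \<times> A. \<Gamma> i)
      \<union> ((\<lambda>p. (p, p)) ` S \<union> (\<lambda>(a, x). ((a, x), (- a - x, x))) ` S)"
    proof (cases "x = y")
      case True
      have "x \<noteq> 0" using m S(1) nz by auto
      moreover have "x * ((a - d) * (a + d + x)) = 0"
        using e True by (simp add: f_poly_def algebra_simps)
      ultimately have "a = d \<or> d = - a - x" by auto
      thus ?thesis using m True unfolding pq by force
    next
      case False
      hence "pq \<in> (\<lambda>((a, d), (x, y)). ((a, x), (d, y))) ` (SIGMA i:A \<times> A. \<Gamma> i)"
        unfolding pq using m e S(1)
        by (intro image_eqI[of _ _ "((a, d), (x, y))"]) (auto simp: \<Gamma>_def)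
      thus ?thesis by blast
    qed
  qed
  hence "card E \<le> card ((\<lambda>((a, d), (x, y)). ((a, x), (d, y))) ` (SIGMA i:A \<times> A. \<Gamma> i)
      \<union> ((\<lambda>p. (p, p)) ` S \<union> (\<lambda>(a, x). ((a, x), (- a - x, x))) ` S))"
    by (rule card_mono[rotated]) (use fin finG finS in auto)
  also have "\<dots> \<le> card (SIGMA i:A \<times> A. \<Gamma> i) + (card S + card S)"
    by (intro order_trans[OF card_Un_le] add_mono card_image_le) (use fin finG finS in auto)
  also have "card (SIGMA i:A \<times> A. \<Gamma> i) = (\<Sum>i\<in>A \<times> A. card (\<Gamma> i))"
    by (rule card_SigmaI) (use fin finG in auto)
  also have "card S \<le> card A * card B"
    using card_mono[OF _ S(1)] fin by (simp add: card_cartesian_product)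
  finally have "card E \<le> (\<Sum>i\<in>A \<times> A. card (\<Gamma> i)) + 2 * (card A * card B)" by linarith
  hence "real (card E) \<le> real (\<Sum>i\<in>A \<times> A. card (\<Gamma> i)) + 2 * real (card A) * real (card B)"
    using of_nat_mono[where ?'a = real] by fastforce
  thus ?thesis using main
    by (simp add: card_cartesian_product power2_eq_square mult.assoc)
qed

text \<open>Cauchy-Schwarz for the sizes of the fibres of \<open>h\<close>: their sum is \<open>|S|\<close>, and the sum of their
  squares is the number of coincidences.\<close>

lemma card_sq_le_card_image_energy:
  assumes "finite S"
  shows "(real (card S))\<^sup>2 \<le> real (card (h ` S)) * real (card {(p, q). p \<in> S \<and> q \<in> S \<and> h p = h q})"
proof -
  define F where "F z = {p \<in> S. h p = z}" for z
  have finF: "finite (F z)" for z using assms by (simp add: F_def)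
  have cS: "card S = (\<Sum>z\<in>h ` S. card (F z))"
    unfolding F_def card_eq_sum by (rule sum.image_gen[OF assms])
  have "bij_betw (\<lambda>(z, pq). pq) (SIGMA z:h ` S. F z \<times> F z) {(p, q). p \<in> S \<and> q \<in> S \<and> h p = h q}"
    unfolding bij_betw_def F_def by (auto simp: inj_on_def image_iff)
  hence "card {(p, q). p \<in> S \<and> q \<in> S \<and> h p = h q} = card (SIGMA z:h ` S. F z \<times> F z)"
    by (simp add: bij_betw_same_card)
  also have "\<dots> = (\<Sum>z\<in>h ` S. card (F z \<times> F z))"
    by (rule card_SigmaI) (use assms finF in auto)
  finally have cE: "real (card {(p, q). p \<in> S \<and> q \<in> S \<and> h p = h q}) = (\<Sum>z\<in>h ` S. (real (card (F z)))\<^sup>2)"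
    by (simp add: card_cartesian_product power2_eq_square)
  show ?thesis
    unfolding cE cS of_nat_sum
    using sum_squared_le_sum_of_squares[of "\<lambda>z. real (card (F z))" "h ` S"] by (simp add: mult.commute)
qed

section \<open>The expander bound\<close>

lemma image_prod_eq_image: "image_prod f A B = case_prod f ` (A \<times> B)"
  by (auto simp: image_prod_def)

text \<open>For a single nonzero \<open>a\<close>, the quadratic function \<open>f(a,\<cdot>)\<close> is injective on each side of its
  vertex.\<close>

lemma card_le_2_card_image_prod:
  assumes fin: "finite A" "finite B" and A: "A \<noteq> {}" "0 \<notin> A"
  shows "card B \<le> 2 * card (image_prod f_poly A B)"
proof -
  obtain a where a: "a \<in> A" "a \<noteq> 0" using A by auto
  have part: "card {b \<in> B. 0 \<le> a + 2 * b \<longleftrightarrow> v} \<le> card (image_prod f_poly A B)" for v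
  proof (rule card_inj_on_le[of "f_poly a"])
    show "inj_on (f_poly a) {b \<in> B. 0 \<le> a + 2 * b \<longleftrightarrow> v}"
    proof (rule inj_onI)
      fix x y assume "x \<in> {b \<in> B. 0 \<le> a + 2 * b \<longleftrightarrow> v}" "y \<in> {b \<in> B. 0 \<le> a + 2 * b \<longleftrightarrow> v}"
        and e: "f_poly a x = f_poly a y"
      hence "0 \<le> a + 2 * x \<longleftrightarrow> v" "0 \<le> a + 2 * y \<longleftrightarrow> v" by auto
      thus "x = y"
        using f_poly_less_iff[OF a(2), of x v y] f_poly_less_iff[OF a(2), of y v x] e
        by (auto split: if_splits)
    qed
  qed (use a fin in \<open>auto simp: image_prod_eq_image\<close>)
  have "card B \<le> card {b \<in> B. 0 \<le> a + 2 * b \<longleftrightarrow> True} + card {b \<in> B. 0 \<le> a + 2 * b \<longleftrightarrow> False}"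
    by (rule order_trans[OF card_mono card_Un_le]) (use fin in auto)
  thus ?thesis using part[of True] part[of False] by linarith
qed

text \<open>Put \<open>|A| = x\<^sup>3\<close> and \<open>|B| = y\<^sup>3\<close>. The block size is \<open>\<tau> = x\<^sup>2/y\<close> rounded up, which at most
  doubles it when \<open>\<tau> \<ge> 1\<close>. Then the energy is at most \<open>(3 + 12 + 2) x\<^sup>4 y\<^sup>4\<close>, and with the factor
  \<open>4\<^sup>2\<close> lost in the restriction to \<open>S\<close> the constant becomes \<open>16 \<cdot> 17 = 272\<close>.\<close>

lemma card_image_prod_f_poly_ge:
  assumes fin: "finite A" "finite B" and ne: "A \<noteq> {}" "B \<noteq> {}" and nz: "0 \<notin> A" "0 \<notin> B"
    and le: "card A \<le> card B"
  shows "real (card (image_prod f_poly A B))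
      \<ge> (1 / 272) * (real (card A) powr (2/3) * real (card B) powr (2/3))"
proof -
  define F where "F = image_prod f_poly A B"
  define x y where "x = real (card A) powr (1/3)" and "y = real (card B) powr (1/3)"
  have pos: "0 < card A" "0 < card B" using fin ne by (auto simp: card_gt_0_iff)
  have m: "real (card A) = x ^ 3" and n: "real (card B) = y ^ 3"
    using pos unfolding x_def y_def by (simp_all add: powr_power)
  have W: "real (card A) powr (2/3) * real (card B) powr (2/3) = x\<^sup>2 * y\<^sup>2"
    using pos unfolding x_def y_def by (simp add: powr_power)
  have x1: "1 \<le> x" and y1: "1 \<le> y" using pos unfolding x_def y_def
    by (simp_all add: ge_one_powr_ge_zero)
  have xy: "x \<le> y" unfolding x_def y_def using le by (intro powr_mono2) auto
  show ?thesis
  proof (cases "y \<le> x\<^sup>2")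
    case False
    have "y ^ 3 \<le> 2 * real (card F)"
      using of_nat_mono[OF card_le_2_card_image_prod[OF fin ne(1) nz(1)], where ?'a = real] n
      unfolding F_def by simp
    moreover have "x\<^sup>2 * y\<^sup>2 \<le> y * y\<^sup>2" using False by (intro mult_right_mono) auto
    ultimately show ?thesis unfolding W F_def[symmetric]
      by (simp add: power3_eq_cube power2_eq_square mult.assoc)
  next
    case True
    define \<tau> where "\<tau> = x\<^sup>2 / y"
    define t where "t = nat \<lceil>\<tau>\<rceil>"
    have \<tau>1: "1 \<le> \<tau>" unfolding \<tau>_def using True y1 by simp
    have t\<tau>: "\<tau> \<le> real t" "real t \<le> 2 * \<tau>" unfolding t_def using \<tau>1 by linarith+
    have "x\<^sup>2 \<le> y\<^sup>2" using xy x1 by (intro power_mono) auto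
    hence "\<tau> \<le> y" unfolding \<tau>_def using y1 by (simp add: field_simps power2_eq_square)
    also have "y \<le> y ^ 3" using y1 by (rule self_le_power) simp
    finally have "\<tau> \<le> real (card B)" using n by simp
    hence tB: "t \<le> card B" unfolding t_def by linarith
    have t0: "0 < t" using t\<tau> \<tau>1 by linarith
    obtain S where S: "S \<subseteq> A \<times> B" "card A * card B \<le> 4 * card S" "increasing_fibres S"
      using large_increasing_subset[OF fin nz(1)] by metis
    define E where "E = {(p, q). p \<in> S \<and> q \<in> S \<and> case_prod f_poly p = case_prod f_poly q}"
    have finS: "finite S" using S(1) fin finite_subset by blast
    have "real (card E) \<le> 3 * (x ^ 3)\<^sup>2 * y ^ 3 / real t + 3 * (y ^ 3)\<^sup>2 * (real t)\<^sup>2 + 2 * x ^ 3 * y ^ 3"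
      using energy_le[OF fin nz S(1,3) t0 tB] unfolding E_def m n .
    also have "\<dots> \<le> 3 * (x ^ 3)\<^sup>2 * y ^ 3 / \<tau> + 3 * (y ^ 3)\<^sup>2 * (2 * \<tau>)\<^sup>2 + 2 * x ^ 3 * y ^ 3"
      using t\<tau> \<tau>1 x1 y1
      by (intro add_mono mult_left_mono divide_left_mono power_mono mult_pos_pos) auto
    also have "\<dots> = 15 * (x ^ 4 * y ^ 4) + 2 * (x ^ 3 * y ^ 3)"
      unfolding \<tau>_def using x1 y1 by (simp add: field_simps eval_nat_numeral)
    also have "x ^ 3 * y ^ 3 \<le> x ^ 4 * y ^ 4"
      using x1 y1 by (intro mult_mono power_increasing) auto
    finally have E: "real (card E) \<le> 17 * (x ^ 4 * y ^ 4)" by simp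
    have "real (card A * card B) \<le> real (4 * card S)" using S(2) by (rule of_nat_mono)
    hence "(x ^ 3 * y ^ 3 / 4)\<^sup>2 \<le> (real (card S))\<^sup>2"
      using x1 y1 by (intro power_mono) (simp_all add: m n)
    also have "\<dots> \<le> real (card (case_prod f_poly ` S)) * real (card E)"
      unfolding E_def by (rule card_sq_le_card_image_energy[OF finS])
    also have "\<dots> \<le> real (card F) * (17 * (x ^ 4 * y ^ 4))"
    proof (intro mult_mono E of_nat_mono)
      show "card (case_prod f_poly ` S) \<le> card F"
        unfolding F_def image_prod_eq_image by (rule card_mono) (use fin S(1) in auto)
    qed auto
    finally have "(x ^ 4 * y ^ 4) * (x\<^sup>2 * y\<^sup>2) \<le> (x ^ 4 * y ^ 4) * (272 * real (card F))"
      by (simp add: field_simps eval_nat_numeral)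
    moreover have "0 < x ^ 4 * y ^ 4" using x1 y1 by simp
    ultimately have "x\<^sup>2 * y\<^sup>2 \<le> 272 * real (card F)" by (meson mult_le_cancel_left_pos)
    thus ?thesis unfolding W F_def[symmetric] by simp
  qed
qed

theorem proposition8p3:
  shows "\<exists>\<kappa>::real. \<kappa> > 0 \<and>
    (\<forall>A B :: real set.
       finite A \<longrightarrow> A \<noteq> {} \<longrightarrow> 0 \<notin> A \<longrightarrow>
       finite B \<longrightarrow> B \<noteq> {} \<longrightarrow> 0 \<notin> B \<longrightarrow>
       real (card (image_prod f_poly A B)) \<ge>
         \<kappa> * real (card A) powr (2/3) * real (card B) powr (2/3))"
proof (intro exI[of _ "1 / 272"] conjI allI impI)
  fix A B :: "real set"
  assume AB: "finite A" "A \<noteq> {}" "0 \<notin> A" "finite B" "B \<noteq> {}" "0 \<notin> B"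
  have comm: "image_prod f_poly A B = image_prod f_poly B A"
    unfolding image_prod_def using f_poly_commute by auto
  show "1 / 272 * real (card A) powr (2/3) * real (card B) powr (2/3)
      \<le> real (card (image_prod f_poly A B))"
  proof (cases "card A \<le> card B")
    case True
    thus ?thesis using card_image_prod_f_poly_ge[of A B] AB by simp
  next
    case False
    thus ?thesis using card_image_prod_f_poly_ge[of B A] AB comm by (simp add: mult.commute)
  qed
qed simp

end
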